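(* Each of the following 47 varieties is equal to $\mathcal{SL}$: $\mathcal{A}_{13}$, $\mathcal{A}_{14}$, $\mathcal{A}_{15}$, $\mathcal{A}_{24}$, $\mathcal{A}_{34}$, $\mathcal{A}_{45}$, $\mathcal{B}_{12}$, $\mathcal{B}_{14}$, $\mathcal{B}_{15}$, $\mathcal{B}_{23}$, $\mathcal{B}_{24}$, $\mathcal{B}_{34}$, $\mathcal{B}_{35}$, $\mathcal{B}_{45}$, $\mathcal{C}_{12}$, $\mathcal{C}_{13}$, $\mathcal{C}_{14}$, $\mathcal{C}_{15}$, $\mathcal{C}_{23}$, $\mathcal{C}_{24}$, $\mathcal{C}_{34}$, $\mathcal{C}_{35}$, $\mathcal{C}_{45}$, $\mathcal{D}_{13}$, $\mathcal{D}_{14}$, $\mathcal{D}_{15}$, $\mathcal{D}_{23}$, $\mathcal{D}_{24}$, $\mathcal{D}_{34}$, $\mathcal{D}_{45}$, $\mathcal{E}_{12}$, $\mathcal{E}_{13}$, $\mathcal{E}_{14}$, $\mathcal{E}_{15}$, $\mathcal{E}_{23}$, $\mathcal{E}_{24}$, $\mathcal{E}_{34}$, $\mathcal{E}_{35}$, $\mathcal{E}_{45}$, $\mathcal{F}_{12}$, $\mathcal{F}_{14}$, $\mathcal{F}_{15}$, $\mathcal{F}_{23}$, $\mathcal{F}_{24}$, $\mathcal{F}_{34}$, $\mathcal{F}_{35}$, $\mathcal{F}_{45}$.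
   Context: A zroupoid is an algebra $\langle A,\to,0\rangle$ with $\to$ binary and $0$ a constant; write $x' := x\to 0$. An implication zroupoid ($\mathcal I$-zroupoid) is a zroupoid satisfying (I) $(x\to y)\to z \approx ((z'\to x)\to(y\to z)')'$ and (I$_0$) $0''\approx 0$. Let $\mathcal S$ be the variety of $\mathcal I$-zroupoids satisfying $x''\approx x$ and $(x\to y')'\approx (y\to x')'$ (symmetric $\mathcal I$-zroupoids). $\mathcal{SL}$ is the variety of $\mathcal I$-zroupoids satisfying $x'\approx x$ and $x\to y\approx y\to x$. Identities of Bol-Moufang type: consider the six words in variables $x,y,z$: A: $xxyz$, B: $xyxz$, C: $xyyz$, D: $xyzx$, E: $xyzy$, F: $xyzz$, and the five bracketings of a word $o_1o_2o_3o_4$ of length 4 with $\to$: 1: $o_1\to(o_2\to(o_3\to o_4))$; 2: $o_1\to((o_2\to o_3)\to o_4)$; 3: $(o_1\to o_2)\to(o_3\to o_4)$; 4: $(o_1\to(o_2\to o_3))\to o_4$; 5: $((o_1\to o_2)\to o_3)\to o_4$. For $X\in\{A,\dots,F\}$ and $1\le i<j\le 5$, $(X_{ij})$ is the identity whose left side is word $X$ bracketed by $i$ and whose right side is word $X$ bracketed by $j$ (e.g. $(A_{12})$: $x\to(x\to(y\to z))\approx x\to((x\to y)\to z)$). $\mathcal X_{ij}$ denotes the subvariety of $\mathcal S$ defined by $(X_{ij})$. *)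

theory Defs
  imports "HOL-Algebra.Congruence"
begin

section \<open>Zroupoids\<close>

record 'a zroupoid = "'a partial_object" +
  imp :: "'a \<Rightarrow> 'a \<Rightarrow> 'a"
  zero :: 'a

definition is_zroupoid :: "'a zroupoid \<Rightarrow> bool" where
  "is_zroupoid A \<longleftrightarrow>
     zero A \<in> carrier A \<and> (\<forall>a \<in> carrier A. \<forall>b \<in> carrier A. imp A a b \<in> carrier A)"

section \<open>Terms, identities and varieties\<close>

datatype zterm =
    Var nat
  | Zero
  | Imp zterm zterm  (infixr \<open>\<rightarrow>\<^sub>t\<close> 60)

abbreviation neg :: "zterm \<Rightarrow> zterm" where
  "neg t \<equiv> t \<rightarrow>\<^sub>t Zero"

abbreviation (input) "vx \<equiv> Var 0"
abbreviation (input) "vy \<equiv> Var 1"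
abbreviation (input) "vz \<equiv> Var 2"

type_synonym identity = "zterm \<times> zterm"

abbreviation identity_of :: "zterm \<Rightarrow> zterm \<Rightarrow> identity"  (infix \<open>\<approx>\<close> 50) where
  "s \<approx> t \<equiv> (s, t)"

primrec eval :: "'a zroupoid \<Rightarrow> (nat \<Rightarrow> 'a) \<Rightarrow> zterm \<Rightarrow> 'a" where
  "eval A v (Var n) = v n"
| "eval A v Zero = zero A"
| "eval A v (s \<rightarrow>\<^sub>t t) = imp A (eval A v s) (eval A v t)"

definition satisfies :: "'a zroupoid \<Rightarrow> identity \<Rightarrow> bool" where
  "satisfies A e \<longleftrightarrow> (\<forall>v. range v \<subseteq> carrier A \<longrightarrow> eval A v (fst e) = eval A v (snd e))"

text \<open>
  A variety is a proper class; it is represented by its members whose carrier is a subset of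
  the type \<^typ>\<open>'a\<close>. Since \<^typ>\<open>'a\<close> is arbitrary, equality of two varieties as sets, stated
  polymorphically, covers all algebras.
\<close>

definition variety :: "identity set \<Rightarrow> 'a zroupoid set" where
  "variety E = {A. is_zroupoid A \<and> (\<forall>e \<in> E. satisfies A e)}"

section \<open>Implication zroupoids\<close>

definition I_axioms :: "identity set" where
  "I_axioms =
     {(vx \<rightarrow>\<^sub>t vy) \<rightarrow>\<^sub>t vz \<approx> neg ((neg vz \<rightarrow>\<^sub>t vx) \<rightarrow>\<^sub>t neg (vy \<rightarrow>\<^sub>t vz)),
      neg (neg Zero) \<approx> Zero}"

definition \<S> :: "'a zroupoid set" where
  "\<S> = variety (I_axioms \<union>
     {neg (neg vx) \<approx> vx,
      neg (vx \<rightarrow>\<^sub>t neg vy) \<approx> neg (vy \<rightarrow>\<^sub>t neg vx)})"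

definition \<S>\<L> :: "'a zroupoid set" where
  "\<S>\<L> = variety (I_axioms \<union>
     {neg vx \<approx> vx,
      vx \<rightarrow>\<^sub>t vy \<approx> vy \<rightarrow>\<^sub>t vx})"

section \<open>Identities of Bol-Moufang type\<close>

datatype bm_word = WA | WB | WC | WD | WE | WF

primrec letters :: "bm_word \<Rightarrow> zterm \<times> zterm \<times> zterm \<times> zterm" where
  "letters WA = (vx, vx, vy, vz)"
| "letters WB = (vx, vy, vx, vz)"
| "letters WC = (vx, vy, vy, vz)"
| "letters WD = (vx, vy, vz, vx)"
| "letters WE = (vx, vy, vz, vy)"
| "letters WF = (vx, vy, vz, vz)"

text \<open>The bracketing index ranges over \<open>1, \<dots>, 5\<close>; other indices are meaningless.\<close>

definition bracketing :: "nat \<Rightarrow> zterm \<times> zterm \<times> zterm \<times> zterm \<Rightarrow> zterm" where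
  "bracketing i w = (case w of (p, q, r, s) \<Rightarrow>
     [p \<rightarrow>\<^sub>t (q \<rightarrow>\<^sub>t (r \<rightarrow>\<^sub>t s)),
      p \<rightarrow>\<^sub>t ((q \<rightarrow>\<^sub>t r) \<rightarrow>\<^sub>t s),
      (p \<rightarrow>\<^sub>t q) \<rightarrow>\<^sub>t (r \<rightarrow>\<^sub>t s),
      (p \<rightarrow>\<^sub>t (q \<rightarrow>\<^sub>t r)) \<rightarrow>\<^sub>t s,
      ((p \<rightarrow>\<^sub>t q) \<rightarrow>\<^sub>t r) \<rightarrow>\<^sub>t s] ! (i - 1))"

definition bm_identity :: "bm_word \<Rightarrow> nat \<Rightarrow> nat \<Rightarrow> identity" where
  "bm_identity X i j = (bracketing i (letters X) \<approx> bracketing j (letters X))"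

definition bm_variety :: "bm_word \<Rightarrow> nat \<Rightarrow> nat \<Rightarrow> 'a zroupoid set" where
  "bm_variety X i j = {A \<in> \<S>. satisfies A (bm_identity X i j)}"

end

theory Submission
  imports Defs
begin

text \<open>
  In a symmetric implication zroupoid the elements \<open>0\<close> and \<open>0'\<close> form a copy of the two-element
  Boolean algebra, or coincide. All the identities in question fail in that Boolean algebra, hence
  they force \<open>0' = 0\<close>. If \<open>0' = 0\<close>, the subalgebra generated by an element \<open>a\<close> is
  \<open>{0, a, a', a \<rightarrow> a}\<close> with a known operation table. Substituting \<open>a\<close> for one variable and \<open>0\<close> for
  the two others in the identity then yields \<open>a' = a\<close>, and symmetry becomes commutativity.
  Conversely, members of \<open>\<S>\<L>\<close> are semilattices with identity element \<open>0\<close>, where all bracketings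
  of a word agree.
\<close>

text \<open>A valuation must send every index into the carrier. The identities in use mention at
  most three variables, so all indices from 2 on receive \<open>c\<close>.\<close>

lemma satisfiesD3:
  assumes "satisfies A e" "a \<in> carrier A" "b \<in> carrier A" "c \<in> carrier A"
  shows "eval A (\<lambda>n. if n = 0 then a else if n = 1 then b else c) (fst e) =
         eval A (\<lambda>n. if n = 0 then a else if n = 1 then b else c) (snd e)"
  using assms unfolding satisfies_def by (auto simp: image_subset_iff)

section \<open>Implication zroupoids and the subalgebra of 0 and 0'\<close>

locale implication_zroupoid =
  fixes A :: "'a zroupoid"
  assumes zroupoid: "is_zroupoid A"
    and I_axioms: "e \<in> I_axioms \<Longrightarrow> satisfies A e"
begin

abbreviation arrow (infixr \<open>\<rightharpoonup>\<close> 60) where "a \<rightharpoonup> b \<equiv> imp A a b"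
abbreviation origin (\<open>\<o>\<close>) where "\<o> \<equiv> zero A"

lemma zero_closed [simp, intro]: "\<o> \<in> carrier A"
  using zroupoid by (simp add: is_zroupoid_def)

lemma arrow_closed [simp, intro]:
  "\<lbrakk>a \<in> carrier A; b \<in> carrier A\<rbrakk> \<Longrightarrow> a \<rightharpoonup> b \<in> carrier A"
  using zroupoid by (simp add: is_zroupoid_def)

lemma arrow_arrow:
  assumes "a \<in> carrier A" "b \<in> carrier A" "c \<in> carrier A"
  shows "(a \<rightharpoonup> b) \<rightharpoonup> c = (((c \<rightharpoonup> \<o>) \<rightharpoonup> a) \<rightharpoonup> ((b \<rightharpoonup> c) \<rightharpoonup> \<o>)) \<rightharpoonup> \<o>"
  using satisfiesD3[OF I_axioms assms, of "(vx \<rightarrow>\<^sub>t vy) \<rightarrow>\<^sub>t vz \<approx>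
      neg ((neg vz \<rightarrow>\<^sub>t vx) \<rightarrow>\<^sub>t neg (vy \<rightarrow>\<^sub>t vz))"]
  by (simp add: I_axioms_def)

end

locale symmetric_zroupoid = implication_zroupoid +
  assumes neg_neg_identity: "satisfies A (neg (neg vx) \<approx> vx)"
    and symmetry_identity: "satisfies A (neg (vx \<rightarrow>\<^sub>t neg vy) \<approx> neg (vy \<rightarrow>\<^sub>t neg vx))"
begin

lemma neg_neg [simp]: "a \<in> carrier A \<Longrightarrow> (a \<rightharpoonup> \<o>) \<rightharpoonup> \<o> = a"
  using satisfiesD3[OF neg_neg_identity, of a a a] by simp

lemma neg_eq_iff:
  "\<lbrakk>a \<in> carrier A; b \<in> carrier A\<rbrakk> \<Longrightarrow> a \<rightharpoonup> \<o> = b \<rightharpoonup> \<o> \<longleftrightarrow> a = b"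
  by (metis neg_neg)

lemma symmetric:
  assumes "a \<in> carrier A" "b \<in> carrier A"
  shows "a \<rightharpoonup> (b \<rightharpoonup> \<o>) = b \<rightharpoonup> (a \<rightharpoonup> \<o>)"
  using satisfiesD3[OF symmetry_identity assms assms(1)] assms by (simp add: neg_eq_iff)

lemma one_arrow [simp]:
  assumes "a \<in> carrier A"
  shows "(\<o> \<rightharpoonup> \<o>) \<rightharpoonup> a = a"
proof -
  \<comment> \<open>In axiom (I) at a, 0, 0 the second factor (0 \<rightarrow> 0)' is 0'' =
    0.\<close>
  have "(a \<rightharpoonup> \<o>) \<rightharpoonup> \<o> = (((\<o> \<rightharpoonup> \<o>) \<rightharpoonup> a) \<rightharpoonup> \<o>) \<rightharpoonup> \<o>"
    using arrow_arrow[of a \<o> \<o>] assms by (simp add: neg_eq_iff)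
  then show ?thesis using assms by simp
qed

text \<open>Axiom (I) at 0, 0, 0'. With \<open>neg_neg\<close> and \<open>one_arrow\<close> this
  completes the table of Boolean implication on 0 (false) and 0' (true).\<close>

lemma zero_arrow_one [simp]: "\<o> \<rightharpoonup> \<o> \<rightharpoonup> \<o> = \<o> \<rightharpoonup> \<o>"
  using arrow_arrow[of \<o> \<o> "\<o> \<rightharpoonup> \<o>"] by simp

section \<open>One-generated subalgebras when 0' = 0\<close>

context
  assumes zero_zero: "\<o> \<rightharpoonup> \<o> = \<o>"
begin

lemma zero_arrow: "a \<in> carrier A \<Longrightarrow> \<o> \<rightharpoonup> a = a"
  using one_arrow[of a] zero_zero by simp

lemma arrow_neg:
  assumes "a \<in> carrier A"
  shows "a \<rightharpoonup> (a \<rightharpoonup> \<o>) = a \<rightharpoonup> \<o>"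
proof -
  \<comment> \<open>Axiom (I) at 0, 0, a, where 0 is now a left identity.\<close>
  have "a = (a \<rightharpoonup> (a \<rightharpoonup> \<o>)) \<rightharpoonup> \<o>"
    using arrow_arrow[of \<o> \<o> a] assms by (simp add: zero_zero zero_arrow)
  then show ?thesis using assms by (metis arrow_closed neg_neg zero_closed)
qed

lemma neg_arrow: "a \<in> carrier A \<Longrightarrow> (a \<rightharpoonup> \<o>) \<rightharpoonup> a = a"
  using arrow_neg[of "a \<rightharpoonup> \<o>"] by simp

lemma neg_arrow_neg: "a \<in> carrier A \<Longrightarrow> (a \<rightharpoonup> \<o>) \<rightharpoonup> (a \<rightharpoonup> \<o>) = a \<rightharpoonup> a"
  using symmetric[of a "a \<rightharpoonup> \<o>"] by simp

lemma square_arrow_neg_square: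
  assumes "a \<in> carrier A"
  shows "(a \<rightharpoonup> a) \<rightharpoonup> a = (a \<rightharpoonup> a) \<rightharpoonup> \<o>"
proof -
  \<comment> \<open>Axiom (I) at a, 0, a': its left side is a' \<rightarrow> a', which equals a
    \<rightarrow> a.\<close>
  have "a \<rightharpoonup> a = ((a \<rightharpoonup> a) \<rightharpoonup> a) \<rightharpoonup> \<o>"
    using arrow_arrow[of a \<o> "a \<rightharpoonup> \<o>"] assms by (simp add: zero_arrow neg_arrow_neg)
  then show ?thesis using assms by (metis arrow_closed neg_neg)
qed

text \<open>With e = a \<rightarrow> a, the product e \<rightarrow> a is computed in two ways:
  \<open>square_arrow_neg_square\<close> gives e', while axiom (I) with symmetry gives e.\<close>

lemma neg_square:
  assumes "a \<in> carrier A"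
  shows "(a \<rightharpoonup> a) \<rightharpoonup> \<o> = a \<rightharpoonup> a"
proof -
  let ?e = "a \<rightharpoonup> a"
  have "?e \<rightharpoonup> a = (a \<rightharpoonup> (?e \<rightharpoonup> \<o>)) \<rightharpoonup> \<o>"
    using arrow_arrow[of a a a] assms by (simp add: neg_arrow)
  also have "\<dots> = (?e \<rightharpoonup> (a \<rightharpoonup> \<o>)) \<rightharpoonup> \<o>"
    using assms by (simp add: symmetric)
  \<comment> \<open>Since a and a' have the same square e, the previous lemma at a' yields e
    \<rightarrow> a' = e'.\<close>
  also have "\<dots> = ?e"
    using square_arrow_neg_square[of "a \<rightharpoonup> \<o>"] assms by (simp add: neg_arrow_neg)
  finally show ?thesis using square_arrow_neg_square assms by simp
qed

lemma square_arrow: "a \<in> carrier A \<Longrightarrow> (a \<rightharpoonup> a) \<rightharpoonup> a = a \<rightharpoonup> a"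
  by (simp add: square_arrow_neg_square neg_square)

lemma square_arrow_neg: "a \<in> carrier A \<Longrightarrow> (a \<rightharpoonup> a) \<rightharpoonup> (a \<rightharpoonup> \<o>) = a \<rightharpoonup> a"
  using square_arrow[of "a \<rightharpoonup> \<o>"] by (simp add: neg_arrow_neg)

lemma arrow_square: "a \<in> carrier A \<Longrightarrow> a \<rightharpoonup> (a \<rightharpoonup> a) = a \<rightharpoonup> a"
  using symmetric[of a "a \<rightharpoonup> a"] by (simp add: neg_square square_arrow_neg)

lemma neg_arrow_square: "a \<in> carrier A \<Longrightarrow> (a \<rightharpoonup> \<o>) \<rightharpoonup> (a \<rightharpoonup> a) = a \<rightharpoonup> a"
  using arrow_square[of "a \<rightharpoonup> \<o>"] by (simp add: neg_arrow_neg)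

lemma square_square: "a \<in> carrier A \<Longrightarrow> (a \<rightharpoonup> a) \<rightharpoonup> (a \<rightharpoonup> a) = a \<rightharpoonup> a"
  using arrow_neg[of "a \<rightharpoonup> a"] by (simp add: neg_square)

text \<open>Together with \<open>neg_neg\<close>, these rules reduce every arrow between 0, a, a'
  and a \<rightarrow> a to one of these four elements.\<close>

lemmas one_generated_table = zero_zero zero_arrow arrow_neg neg_arrow neg_arrow_neg neg_square
  square_arrow square_arrow_neg arrow_square neg_arrow_square square_square

text \<open>By this lemma and the next, a, a' and a \<rightarrow> a are pairwise distinct as soon as
  a' differs from a.\<close>

lemma neg_eq_if_square_eq: "\<lbrakk>a \<in> carrier A; a \<rightharpoonup> a = a\<rbrakk> \<Longrightarrow> a \<rightharpoonup> \<o> = a"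
  using neg_square by fastforce

lemma neg_eq_if_square_eq_neg: "\<lbrakk>a \<in> carrier A; a \<rightharpoonup> a = a \<rightharpoonup> \<o>\<rbrakk> \<Longrightarrow> a \<rightharpoonup> \<o> = a"
  using neg_square[of a] by simp

end

end

lemma symmetric_zroupoid_iff: "symmetric_zroupoid A \<longleftrightarrow> A \<in> \<S>"
  by (auto simp: symmetric_zroupoid_def symmetric_zroupoid_axioms_def implication_zroupoid_def
      \<S>_def variety_def)

section \<open>Semilattice structure of the members of \<S>\<L>\<close>

locale semilattice_zroupoid = implication_zroupoid +
  assumes neg_identity: "satisfies A (neg vx \<approx> vx)"
    and comm_identity: "satisfies A (vx \<rightarrow>\<^sub>t vy \<approx> vy \<rightarrow>\<^sub>t vx)"
begin

lemma neg [simp]: "a \<in> carrier A \<Longrightarrow> a \<rightharpoonup> \<o> = a"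
  using satisfiesD3[OF neg_identity, of a a a] by simp

lemma comm: "\<lbrakk>a \<in> carrier A; b \<in> carrier A\<rbrakk> \<Longrightarrow> a \<rightharpoonup> b = b \<rightharpoonup> a"
  using satisfiesD3[OF comm_identity, of a b a] by simp

lemma distrib:
  "\<lbrakk>a \<in> carrier A; b \<in> carrier A; c \<in> carrier A\<rbrakk> \<Longrightarrow> (a \<rightharpoonup> b) \<rightharpoonup> c = (c \<rightharpoonup> a) \<rightharpoonup> (b \<rightharpoonup> c)"
  using arrow_arrow[of a b c] by simp

lemma zero_arrow [simp]: "a \<in> carrier A \<Longrightarrow> \<o> \<rightharpoonup> a = a"
  using comm[of \<o> a] by simp

lemma left_idem [simp]: "\<lbrakk>a \<in> carrier A; b \<in> carrier A\<rbrakk> \<Longrightarrow> a \<rightharpoonup> (a \<rightharpoonup> b) = a \<rightharpoonup> b"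
  using distrib[of b \<o> a] by (simp add: comm)

text \<open>Applying \<open>distrib\<close> twice makes b \<rightarrow> c a factor on both sides;
  idempotence then absorbs the repeated c and the repeated b \<rightarrow> c.\<close>

lemma assoc:
  assumes "a \<in> carrier A" "b \<in> carrier A" "c \<in> carrier A"
  shows "(a \<rightharpoonup> b) \<rightharpoonup> c = a \<rightharpoonup> (b \<rightharpoonup> c)"
proof -
  have "(a \<rightharpoonup> b) \<rightharpoonup> c = (c \<rightharpoonup> a) \<rightharpoonup> (b \<rightharpoonup> c)"
    using assms by (rule distrib)
  also have "\<dots> = ((b \<rightharpoonup> c) \<rightharpoonup> c) \<rightharpoonup> (a \<rightharpoonup> (b \<rightharpoonup> c))"
    using assms by (intro distrib) auto
  also have "(b \<rightharpoonup> c) \<rightharpoonup> c = b \<rightharpoonup> c"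
    using assms by (metis arrow_closed comm left_idem)
  also have "(b \<rightharpoonup> c) \<rightharpoonup> (a \<rightharpoonup> (b \<rightharpoonup> c)) = a \<rightharpoonup> (b \<rightharpoonup> c)"
    using assms by (metis arrow_closed comm left_idem)
  finally show ?thesis .
qed

lemma bm_identity_holds:
  assumes "i \<in> {1, 2, 3, 4, 5}" "j \<in> {1, 2, 3, 4, 5}"
  shows "satisfies A (bm_identity X i j)"
proof -
  \<comment> \<open>Associativity brings both sides of the identity to the right-nested bracketing
    of the same word.\<close>
  have *: "eval A v (bracketing k (p, q, r, s)) = eval A v (bracketing 1 (p, q, r, s))"
    if "k \<in> {1, 2, 3, 4, 5}" "eval A v ` {p, q, r, s} \<subseteq> carrier A" for v k p q r s
    using that by (auto simp: bracketing_def assoc)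
  have "eval A v ` {p, q, r, s} \<subseteq> carrier A"
    if "range v \<subseteq> carrier A" "letters X = (p, q, r, s)" for v p q r s
    using that by (cases X) auto
  then show ?thesis using *[OF assms(1)] *[OF assms(2)]
    unfolding satisfies_def bm_identity_def
    by (cases "letters X") (metis fst_conv snd_conv)
qed

lemma is_symmetric: "A \<in> \<S>"
proof -
  have "symmetric_zroupoid A"
  proof
    show "satisfies A (neg (neg vx) \<approx> vx)"
      by (auto simp: satisfies_def image_subset_iff)
    show "satisfies A (neg (vx \<rightarrow>\<^sub>t neg vy) \<approx> neg (vy \<rightarrow>\<^sub>t neg vx))"
      by (auto simp: satisfies_def image_subset_iff intro: comm)
  qed
  then show ?thesis by (simp add: symmetric_zroupoid_iff)
qed

end

lemma semilattice_zroupoid_iff: "semilattice_zroupoid A \<longleftrightarrow> A \<in> \<S>\<L>"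
  by (auto simp: semilattice_zroupoid_def semilattice_zroupoid_axioms_def implication_zroupoid_def
      \<S>\<L>_def variety_def)

lemma (in symmetric_zroupoid) semilattice_if_neg_trivial:
  assumes "\<And>a. a \<in> carrier A \<Longrightarrow> a \<rightharpoonup> \<o> = a"
  shows "A \<in> \<S>\<L>"
proof -
  have "semilattice_zroupoid A"
  proof
    show "satisfies A (neg vx \<approx> vx)"
      using assms by (auto simp: satisfies_def image_subset_iff)
    show "satisfies A (vx \<rightarrow>\<^sub>t vy \<approx> vy \<rightarrow>\<^sub>t vx)"
      using symmetric assms by (auto simp: satisfies_def image_subset_iff)
  qed
  then show ?thesis by (simp add: semilattice_zroupoid_iff)
qed

section \<open>The listed Bol-Moufang identities\<close>

definition bm_semilattice_indices :: "(bm_word \<times> nat \<times> nat) set" where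
  "bm_semilattice_indices = {
      (WA, 1, 3), (WA, 1, 4), (WA, 1, 5), (WA, 2, 4), (WA, 3, 4),
      (WA, 4, 5),
      (WB, 1, 2), (WB, 1, 4), (WB, 1, 5), (WB, 2, 3), (WB, 2, 4),
      (WB, 3, 4), (WB, 3, 5), (WB, 4, 5),
      (WC, 1, 2), (WC, 1, 3), (WC, 1, 4), (WC, 1, 5), (WC, 2, 3),
      (WC, 2, 4), (WC, 3, 4), (WC, 3, 5), (WC, 4, 5),
      (WD, 1, 3), (WD, 1, 4), (WD, 1, 5), (WD, 2, 3), (WD, 2, 4),
      (WD, 3, 4), (WD, 4, 5),
      (WE, 1, 2), (WE, 1, 3), (WE, 1, 4), (WE, 1, 5), (WE, 2, 3),
      (WE, 2, 4), (WE, 3, 4), (WE, 3, 5), (WE, 4, 5),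
      (WF, 1, 2), (WF, 1, 4), (WF, 1, 5), (WF, 2, 3), (WF, 2, 4),
      (WF, 3, 4), (WF, 3, 5), (WF, 4, 5)}"

context symmetric_zroupoid
begin

lemma bm_zero_zero:
  assumes "satisfies A (bm_identity X i j)" "(X, i, j) \<in> bm_semilattice_indices"
  shows "\<o> \<rightharpoonup> \<o> = \<o>"
proof -
  let ?l = "\<o> \<rightharpoonup> \<o>"
  note I = satisfiesD3[OF assms(1)]
  \<comment> \<open>These are all eight Boolean assignments. Each listed identity fails at one of
    them in the two-element Boolean algebra, and there its instance equates 0 and 0'.\<close>
  note facts = I[of \<o> \<o> \<o>] I[of \<o> \<o> ?l] I[of \<o> ?l \<o>] I[of \<o> ?l ?l]
    I[of ?l \<o> \<o>] I[of ?l \<o> ?l] I[of ?l ?l \<o>] I[of ?l ?l ?l]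
  show ?thesis
    using assms(2) unfolding bm_semilattice_indices_def
    by (elim insertE emptyE; use facts in \<open>simp add: bm_identity_def bracketing_def\<close>)
qed

lemma bm_neg_trivial:
  assumes "satisfies A (bm_identity X i j)" "(X, i, j) \<in> bm_semilattice_indices"
    and a: "a \<in> carrier A"
  shows "a \<rightharpoonup> \<o> = a"
proof -
  note I = satisfiesD3[OF assms(1)]
  note facts = I[of a \<o> \<o>] I[of \<o> a \<o>] I[of \<o> \<o> a]
  note zz = bm_zero_zero[OF assms(1,2)]
  show ?thesis
  proof (rule ccontr)
    assume n: "a \<rightharpoonup> \<o> \<noteq> a"
    then have "a \<rightharpoonup> a \<noteq> a" "a \<rightharpoonup> a \<noteq> a \<rightharpoonup> \<o>"
      using neg_eq_if_square_eq[OF zz a] neg_eq_if_square_eq_neg[OF zz a] by auto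
    \<comment> \<open>Both orientations are supplied, as an instance may equate the elements in
      either order.\<close>
    note n = n this n[symmetric] this[symmetric]
    show False
      using assms(2) unfolding bm_semilattice_indices_def
      \<comment> \<open>For each listed identity, the table turns one of the three instances into an
        equation between two different ones of a, a' and a \<rightarrow> a.\<close>
      by (elim insertE emptyE; use facts a n in \<open>simp add: bm_identity_def bracketing_def one_generated_table[OF zz]\<close>)
  qed
qed

end

lemma bm_variety_eq_SL:
  assumes "(X, i, j) \<in> bm_semilattice_indices"
  shows "bm_variety X i j = \<S>\<L>"
proof (intro equalityI subsetI)
  fix A :: "'a zroupoid"
  assume "A \<in> bm_variety X i j"
  then have A: "symmetric_zroupoid A" "satisfies A (bm_identity X i j)"
    by (simp_all add: bm_variety_def symmetric_zroupoid_iff)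
  interpret symmetric_zroupoid A by (fact A)
  show "A \<in> \<S>\<L>"
    using bm_neg_trivial[OF A(2) assms] by (rule semilattice_if_neg_trivial)
next
  fix A :: "'a zroupoid"
  assume "A \<in> \<S>\<L>"
  then interpret semilattice_zroupoid A by (simp add: semilattice_zroupoid_iff)
  have "i \<in> {1, 2, 3, 4, 5}" "j \<in> {1, 2, 3, 4, 5}"
    using assms by (auto simp: bm_semilattice_indices_def)
  then show "A \<in> bm_variety X i j"
    by (simp add: bm_variety_def is_symmetric bm_identity_holds)
qed

theorem theorem3p7:
  shows "\<forall>(X, i, j) \<in> {
      (WA, 1, 3), (WA, 1, 4), (WA, 1, 5), (WA, 2, 4), (WA, 3, 4),
      (WA, 4, 5),
      (WB, 1, 2), (WB, 1, 4), (WB, 1, 5), (WB, 2, 3), (WB, 2, 4),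
      (WB, 3, 4), (WB, 3, 5), (WB, 4, 5),
      (WC, 1, 2), (WC, 1, 3), (WC, 1, 4), (WC, 1, 5), (WC, 2, 3),
      (WC, 2, 4), (WC, 3, 4), (WC, 3, 5), (WC, 4, 5),
      (WD, 1, 3), (WD, 1, 4), (WD, 1, 5), (WD, 2, 3), (WD, 2, 4),
      (WD, 3, 4), (WD, 4, 5),
      (WE, 1, 2), (WE, 1, 3), (WE, 1, 4), (WE, 1, 5), (WE, 2, 3),
      (WE, 2, 4), (WE, 3, 4), (WE, 3, 5), (WE, 4, 5),
      (WF, 1, 2), (WF, 1, 4), (WF, 1, 5), (WF, 2, 3), (WF, 2, 4),
      (WF, 3, 4), (WF, 3, 5), (WF, 4, 5)}.
    bm_variety X i j = (\<S>\<L> :: 'a zroupoid set)"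
  by (fold bm_semilattice_indices_def) (auto simp: bm_variety_eq_SL)

end
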